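(* Let $q$ and $t$ be odd primes such that $q=2t+1$, and let $n\ge u$ be an integer. Then, over $\mathbb{F}_q$, $$x^{2^nt}-1=\prod_{0\le j\le t-1}(x\pm 4^j)\prod_{\substack{2\le k\le u-1\\ 1\le i\le 2^{k-2}\\ 0\le j\le t-1}}\bigl(x^2-4^j\,\mathbb{T}(\beta_{2^k}^{2i-1})\,x+4^{2j}\bigr)\prod_{\substack{0\le r\le n-u\\ 1\le i\le 2^{u-3}\\ 0\le j\le t-1}}\bigl(x^{2^{r+1}}\pm 4^j\,\mathbb{T}(\beta_{2^u}^{2i-1})\,x^{2^r}-4^{2j}\bigr).$$
   Context: $\mathbb{F}_q$ is the finite field with $q$ elements; integers are read as elements of $\mathbb{F}_q$. Here $q\equiv 3\pmod 4$; put $Q=q^2=2^uv+1$ with $v$ odd (so $u\ge 3$). For $0\le k\le u$, $\beta_{2^k}$ is a primitive $2^k$th root of unity in $\mathbb{F}_Q^*$. $\mathbb{T}:\mathbb{F}_Q\to\mathbb{F}_q$ is the trace $\mathbb{T}(x)=x+x^q$. A factor written with $\pm$ in a product stands for the product of the two factors obtained from the two sign choices. *)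

theory Defs
  imports
    "HOL-Library.Cardinality"
    "HOL-Computational_Algebra.Computational_Algebra"
    "HOL-Number_Theory.Residues"
    "Jordan_Normal_Form.Determinant"
begin

hide_const (open) up_ring.monom up_ring.coeff

definition primitive_root_of_unity :: "nat \<Rightarrow> 'a :: field \<Rightarrow> bool" where
  "primitive_root_of_unity m x \<longleftrightarrow> x ^ m = 1 \<and> (\<forall>k. 0 < k \<and> k < m \<longrightarrow> x ^ k \<noteq> 1)"

text \<open>
  The small field with \<open>q\<close> elements is the type \<open>'a\<close>, the field with \<open>q\<^sup>2\<close> elements is the
  type \<open>'b\<close>, and \<open>\<iota>\<close> is the inclusion of the former in the latter. The trace of \<open>x\<close> is
  \<open>x + x ^ q\<close>; this lies in the image of \<open>\<iota>\<close>, and \<open>inv_into UNIV \<iota>\<close> reads it as an element of \<open>'a\<close>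
  (see \<open>embed_quadratic_trace\<close> below).
\<close>
definition quadratic_trace :: "('a :: finite_field \<Rightarrow> 'b :: finite_field) \<Rightarrow> 'b \<Rightarrow> 'a" where
  "quadratic_trace \<iota> x = inv_into UNIV \<iota> (x + x ^ CARD('a))"

lemma embed_quadratic_trace:
  fixes \<iota> :: "'a :: finite_field \<Rightarrow> 'b :: finite_field"
  assumes hom: "field_hom \<iota>"
    and q: "prime CARD('a)" and Q: "CARD('b) = CARD('a) ^ 2"
  shows "\<iota> (quadratic_trace \<iota> x) = x + x ^ CARD('a)"
proof -
  interpret field_hom \<iota> by (rule hom)
  let ?q = "CARD('a)"
  have "CHAR('b) dvd ?q ^ 2" using CHAR_dvd_CARD[where ?'a = 'b] Q by simp
  hence char: "CHAR('b) = ?q"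
    using primes_dvd_imp_eq[OF CHAR_prime q] prime_dvd_power[OF CHAR_prime] by blast
  have q1: "?q > 1" using q prime_gt_1_nat by blast
  have inj: "inj \<iota>" by (rule inj_f)
  define P :: "'b poly" where "P = monom 1 ?q - monom 1 1"
  have coeff: "coeff P ?q = 1" using q1 by (simp add: P_def)
  hence "P \<noteq> 0" by auto
  have "degree P \<le> ?q" unfolding P_def
    using q1 by (intro degree_diff_le) (auto intro: order.trans[OF degree_monom_le])
  have roots: "poly P y = 0 \<longleftrightarrow> y ^ ?q = y" for y by (simp add: P_def poly_monom)
  have "range \<iota> = {y. poly P y = 0}"
  proof (rule card_seteq)
    show "finite {y. poly P y = 0}" by simp
    show "range \<iota> \<subseteq> {y. poly P y = 0}"
      by (auto simp: roots finite_field_power_card_eq_same simp flip: hom_power)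
    have "card {y. poly P y = 0} \<le> degree P"
      using \<open>P \<noteq> 0\<close> by (rule card_poly_roots_bound)
    also have "\<dots> \<le> card (range \<iota>)"
      using \<open>degree P \<le> ?q\<close> inj by (simp add: card_image)
    finally show "card {y. poly P y = 0} \<le> card (range \<iota>)" .
  qed
  moreover have "(x + x ^ ?q) ^ ?q = x + x ^ ?q"
  proof -
    have "(x + x ^ ?q) ^ ?q = x ^ ?q + (x ^ ?q) ^ ?q"
      by (rule freshmans_dream) (use q char in \<open>simp_all only:\<close>)
    also have "(x ^ ?q) ^ ?q = x ^ CARD('b)"
      by (simp only: Q power2_eq_square power_mult)
    also have "\<dots> = x" by (rule finite_field_power_card_eq_same)
    finally show ?thesis by (simp only: add.commute)
  qed
  ultimately have "x + x ^ ?q \<in> range \<iota>" by (simp add: roots)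
  thus ?thesis unfolding quadratic_trace_def by (rule f_inv_into_f)
qed

end

theory Submission
  imports "Jordan_Normal_Form.Char_Poly" Defs
begin

text \<open>
  Put \<open>y = x ^ t\<close>. Repeated use of \<open>y ^ (2 * m) - 1 = (y ^ m - 1) * (y ^ m + 1)\<close> gives
  \<open>y ^ 2 ^ n - 1 = (y\<^sup>2 - 1) * (\<Prod>k = 1..<n. y ^ 2 ^ k + 1)\<close>, and the three products of the theorem
  are the factorizations of the three parts \<open>y\<^sup>2 - 1\<close>, \<open>1 \<le> k < u - 1\<close> and \<open>u - 1 \<le> k < n\<close> of the
  right-hand side.

  Two sources of roots are combined. Since \<open>q - 1 = 2 * t\<close> with \<open>t\<close> prime, \<open>4\<close> is a primitive
  \<open>t\<close>-th root of unity, and so is \<open>4 ^ 2 ^ m\<close> because \<open>t\<close> is odd; hence \<open>(z ^ t) ^ 2 ^ m + 1\<close> is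
  the product of the factors \<open>z ^ 2 ^ m + a ^ 2 ^ m\<close> with \<open>a = 4 ^ j\<close>
  (\<open>scaled_two_power_product\<close>). Each of these splits into the linear factors \<open>z - a * b ^ e\<close>,
  \<open>e\<close> odd, where \<open>b\<close> is a primitive root of unity of order \<open>2 ^ (m + 1)\<close>
  (\<open>odd_power_product\<close>), and the linear factors are grouped into pairs of conjugates under
  \<open>x \<mapsto> x ^ q\<close>.

  What the conjugate of \<open>b\<close> is follows from the fact that \<open>q + 1\<close> is an odd multiple of
  \<open>2 ^ (u - 1)\<close>. If the order of \<open>b\<close> divides \<open>2 ^ (u - 1)\<close>, then \<open>b ^ (q + 1) = 1\<close>, so the
  conjugate is \<open>1 / b\<close>, the trace is \<open>b + 1 / b\<close>, and a pair multiplies to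
  \<open>z\<^sup>2 - a * (b + 1 / b) * z + a\<^sup>2\<close> (\<open>reciprocal_quadratic_product\<close>). If the order is \<open>2 ^ u\<close>,
  then \<open>b ^ (q + 1) = -1\<close>, the conjugate is \<open>- 1 / b\<close>, and the constant term becomes \<open>- a\<^sup>2\<close>
  (\<open>antireciprocal_quadratic_product\<close>). No power of \<open>2\<close> beyond \<open>2 ^ u\<close> divides \<open>q\<^sup>2 - 1\<close>, so
  the large field has no roots of unity of higher two-power order;
  the parts with \<open>k \<ge> u - 1\<close> arise from the one with \<open>k = u - 1\<close> by substituting \<open>x ^ 2 ^ r\<close>
  for \<open>x\<close>.

  All the computations take place over the large field; the identity descends to the small one
  because the inclusion is injective on polynomials.
\<close>

section \<open>Roots of unity in a field\<close>

text \<open>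
  Both sides are obtained by substituting \<open>z\<close> into a monic polynomial of degree \<open>m\<close> that vanishes
  at the \<open>m\<close> distinct powers of \<open>\<omega>\<close>. Allowing a polynomial for \<open>z\<close> makes powers of the
  indeterminate available as arguments.
\<close>
lemma root_of_unity_product:
  fixes z :: "'c :: field poly"
  assumes "primitive_root_of_unity m \<omega>" "m > 0"
  shows "(\<Prod>j<m. z - [:\<omega> ^ j:]) = z ^ m - 1"
proof -
  have w: "\<omega> ^ m = 1" and prim: "\<And>k. 0 < k \<Longrightarrow> k < m \<Longrightarrow> \<omega> ^ k \<noteq> 1"
    using assms(1) by (auto simp: primitive_root_of_unity_def)
  have w0: "\<omega> \<noteq> 0" using w assms(2) by (auto simp: power_0_left)
  have neq: "\<omega> ^ i \<noteq> \<omega> ^ j" if "i < j" "j < m" for i j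
  proof
    assume "\<omega> ^ i = \<omega> ^ j"
    moreover have "\<omega> ^ j = \<omega> ^ i * \<omega> ^ (j - i)" using that by (simp flip: power_add)
    ultimately have "\<omega> ^ (j - i) = 1" using w0 by simp
    thus False using prim[of "j - i"] that by simp
  qed
  have inj: "inj_on (\<lambda>j. \<omega> ^ j) {..<m}"
    by (rule inj_onI) (metis lessThan_iff linorder_neqE_nat neq)
  have "(\<Prod>j<m. [:- (\<omega> ^ j), 1:]) = (monom 1 m - 1 :: 'c poly)"
  proof (rule poly_eqI_degree_lead_coeff[where n = m and A = "(\<lambda>j. \<omega> ^ j) ` {..<m}"])
    show "m \<le> card ((\<lambda>j. \<omega> ^ j) ` {..<m})" using card_image[OF inj] by simp
    show "degree (\<Prod>j<m. [:- (\<omega> ^ j), 1:]) \<le> m"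
      by (rule order.trans[OF degree_prod_sum_le]) auto
    show "degree (monom 1 m - 1 :: 'c poly) \<le> m"
      by (intro degree_diff_le) (auto simp: degree_monom_le)
    have "degree (\<Prod>j<m. [:- (\<omega> ^ j), 1:]) = m"
      by (subst degree_prod_eq_sum_degree) auto
    hence "coeff (\<Prod>j<m. [:- (\<omega> ^ j), 1:]) m = lead_coeff (\<Prod>j<m. [:- (\<omega> ^ j), 1:])" by simp
    also have "\<dots> = 1" by (simp add: lead_coeff_prod)
    finally show "coeff (\<Prod>j<m. [:- (\<omega> ^ j), 1:]) m = coeff (monom 1 m - 1 :: 'c poly) m"
      using assms(2) by simp
    fix x assume "x \<in> (\<lambda>j. \<omega> ^ j) ` {..<m}"
    then obtain j where j: "j < m" "x = \<omega> ^ j" by auto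
    have "x ^ m = (\<omega> ^ m) ^ j" by (simp only: j mult.commute flip: power_mult)
    hence "x ^ m = 1" using w by simp
    thus "poly (\<Prod>j<m. [:- (\<omega> ^ j), 1:]) x = poly (monom 1 m - 1) x"
      using j by (auto simp: poly_prod poly_monom intro!: prod_zero)
  qed
  hence "(\<Prod>j<m. [:- (\<omega> ^ j), 1:]) \<circ>\<^sub>p z = (monom 1 m - 1) \<circ>\<^sub>p z" by simp
  moreover have "(\<Prod>j<m. [:- (\<omega> ^ j), 1:]) \<circ>\<^sub>p z = (\<Prod>j<m. z - [:\<omega> ^ j:])"
    unfolding pcompose_prod
    by (intro prod.cong refl)
       (simp add: pcompose_pCons diff_conv_add_uminus[of z] add.commute)
  moreover have "(monom 1 m - 1) \<circ>\<^sub>p z = z ^ m - 1"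
    by (simp add: pcompose_diff pcompose_1 monom_altdef pcompose_hom.hom_power pcompose_pCons)
  ultimately show ?thesis by simp
qed

lemma root_of_unity_product_plus:
  fixes z :: "'c :: field poly"
  assumes "primitive_root_of_unity m \<omega>" "odd m"
  shows "(\<Prod>j<m. z + [:\<omega> ^ j:]) = z ^ m + 1"
proof -
  have "(\<Prod>j<m. z + [:\<omega> ^ j:]) = (\<Prod>j<m. (- 1) * (- z - [:\<omega> ^ j:]))"
    by (simp only: minus_diff_eq mult_minus1 diff_minus_eq_add add.commute)
  also have "\<dots> = (- 1) ^ m * ((- z) ^ m - 1)"
    using assms by (subst prod.distrib, subst root_of_unity_product) (auto intro: odd_pos)
  also have "\<dots> = z ^ m + 1" using \<open>odd m\<close> by simp
  finally show ?thesis .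
qed

lemma power_eq_1_iff_dvd:
  assumes "primitive_root_of_unity m x" "m > 0"
  shows "x ^ k = 1 \<longleftrightarrow> m dvd k"
proof -
  have "x ^ k = (x ^ m) ^ (k div m) * x ^ (k mod m)" by (simp flip: power_mult power_add)
  also have "\<dots> = x ^ (k mod m)" using assms by (simp add: primitive_root_of_unity_def)
  finally have "x ^ k = 1 \<longleftrightarrow> x ^ (k mod m) = 1" by simp
  also have "\<dots> \<longleftrightarrow> k mod m = 0"
    using assms mod_less_divisor[of m k] by (auto simp: primitive_root_of_unity_def)
  finally show ?thesis by (simp add: dvd_eq_mod_eq_0)
qed

lemma primitive_root_of_unity_power:
  assumes "primitive_root_of_unity m x" "m > 0" "coprime m k"
  shows "primitive_root_of_unity m (x ^ k)"
  using assms(3) unfolding primitive_root_of_unity_def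
  by (auto simp: power_eq_1_iff_dvd[OF assms(1,2)] coprime_dvd_mult_right_iff
      dest: dvd_imp_le simp flip: power_mult)

lemma primitive_root_of_unity_prime:
  fixes x :: "'c :: field"
  assumes "prime p" "x ^ p = 1" "x \<noteq> 1"
  shows "primitive_root_of_unity p x"
  unfolding primitive_root_of_unity_def
proof (intro conjI allI impI notI)
  fix k assume k: "0 < k \<and> k < p" and "x ^ k = 1"
  have "coprime p k" using assms(1) k by (auto intro!: prime_imp_coprime dest: dvd_imp_le)
  then obtain a b where "p * a = k * b + 1"
    using bezout_nat[of p k] assms(1) by auto
  hence "(x ^ p) ^ a = (x ^ k) ^ b * x" by (simp flip: power_mult)
  thus False using assms \<open>x ^ k = 1\<close> by simp
qed (use assms in simp)

lemma primitive_root_half_power: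
  assumes "primitive_root_of_unity (2 ^ Suc k) b"
  shows "b ^ 2 ^ k = -1"
proof -
  have "(b ^ 2 ^ k)\<^sup>2 = 1" and "b ^ 2 ^ k \<noteq> 1"
    using assms by (auto simp: primitive_root_of_unity_def simp flip: power_mult)
       (simp add: mult.commute)
  thus ?thesis by (simp add: power2_eq_1_iff)
qed

text \<open>
  The roots of \<open>X ^ t - 1\<close> are permuted by \<open>x \<mapsto> x ^ 2 ^ m\<close> when \<open>t\<close> is odd, so the scalars may be
  raised to the same power as \<open>z\<close>. In this form the factors are homogeneous in \<open>z\<close> and \<open>\<omega> ^ j\<close>
  and can be split further with a root of \<open>b ^ 2 ^ m = -1\<close>.
\<close>
lemma scaled_two_power_product:
  fixes z :: "'c :: field poly"
  assumes "primitive_root_of_unity t \<omega>" "odd t"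
  shows "(\<Prod>j<t. z ^ 2 ^ m + [:\<omega> ^ j:] ^ 2 ^ m) = (z ^ t) ^ 2 ^ m + 1"
proof -
  have "primitive_root_of_unity t (\<omega> ^ 2 ^ m)"
    using assms by (intro primitive_root_of_unity_power) (auto intro: odd_pos)
  from root_of_unity_product_plus[OF this assms(2), of "z ^ 2 ^ m"] show ?thesis
    by (simp add: poly_const_pow mult.commute flip: power_mult)
qed

section \<open>Products over odd powers in a commutative ring\<close>

lemma prod_atLeast1_double:
  fixes f :: "nat \<Rightarrow> 'c :: comm_monoid_mult"
  shows "(\<Prod>i = 1..2 * m. f i) = (\<Prod>i = 1..m. f i * f (m + i))"
  unfolding prod.distrib
proof -
  have "(\<Prod>i = 1..m + m. f i) = prod f {1..m} * prod f {Suc m..m + m}"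
    using prod.ub_add_nat[of 1 m f m] by simp
  also have "prod f {Suc m..m + m} = (\<Prod>i = 1..m. f (m + i))"
    using prod.shift_bounds_cl_nat_ivl[of f 1 m m] by (simp add: add.commute)
  finally show "(\<Prod>i = 1..2 * m. f i) = (\<Prod>i = 1..m. f i) * (\<Prod>i = 1..m. f (m + i))"
    by (simp add: mult_2)
qed

text \<open>
  The exponents at \<open>i\<close> and \<open>2 ^ (k - 1) + i\<close> differ by \<open>2 ^ k\<close>, so the corresponding powers of \<open>b\<close>
  are opposite and the two factors combine to a difference of squares. This is the same product
  for \<open>x\<^sup>2\<close>, \<open>a\<^sup>2\<close>, \<open>b\<^sup>2\<close>, with half as many factors.
\<close>
lemma odd_power_product:
  fixes a b x :: "'c :: comm_ring_1"
  assumes "b ^ 2 ^ k = -1"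
  shows "(\<Prod>i = 1..2 ^ k. x - a * b ^ (2 * i - 1)) = x ^ 2 ^ k + a ^ 2 ^ k"
  using assms
proof (induction k arbitrary: a b x)
  case 0
  thus ?case by simp
next
  case (Suc k)
  have "(\<Prod>i = 1..2 ^ Suc k. x - a * b ^ (2 * i - 1)) =
      (\<Prod>i = 1..2 ^ k. (x - a * b ^ (2 * i - 1)) * (x - a * b ^ (2 * (2 ^ k + i) - 1)))"
    by (simp only: power_Suc prod_atLeast1_double)
  also have "\<dots> = (\<Prod>i = 1..2 ^ k. x\<^sup>2 - a\<^sup>2 * (b\<^sup>2) ^ (2 * i - 1))"
  proof (rule prod.cong[OF refl])
    fix i :: nat assume "i \<in> {1..2 ^ k}"
    hence "2 * (2 ^ k + i) - 1 = 2 ^ Suc k + (2 * i - 1)" by auto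
    hence "b ^ (2 * (2 ^ k + i) - 1) = - (b ^ (2 * i - 1))"
      using Suc.prems by (simp only: power_add) simp
    moreover have "(b\<^sup>2) ^ (2 * i - 1) = (b ^ (2 * i - 1))\<^sup>2"
      by (simp only: mult.commute flip: power_mult)
    ultimately show "(x - a * b ^ (2 * i - 1)) * (x - a * b ^ (2 * (2 ^ k + i) - 1)) =
        x\<^sup>2 - a\<^sup>2 * (b\<^sup>2) ^ (2 * i - 1)"
      by (simp add: algebra_simps power2_eq_square)
  qed
  also have "\<dots> = (x\<^sup>2) ^ 2 ^ k + (a\<^sup>2) ^ 2 ^ k"
    using Suc.prems by (intro Suc.IH) (simp flip: power_mult)
  finally show ?case by (simp flip: power_mult)
qed

text \<open>
  The exponents \<open>2 * i - 1\<close> with \<open>i \<le> 2 ^ k\<close> and their negatives represent all odd residues modulo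
  \<open>2 ^ (k + 2)\<close>. Thus the two linear factors of these quadratics, one with \<open>b\<close> and one with its
  inverse \<open>c\<close>, run together through the linear factors of \<open>odd_power_product\<close>.
\<close>
lemma reciprocal_quadratic_product:
  fixes a b c x :: "'c :: comm_ring_1"
  assumes "b * c = 1" "b ^ 2 ^ Suc k = -1"
  shows "(\<Prod>i = 1..2 ^ k. x\<^sup>2 - a * (b ^ (2 * i - 1) + c ^ (2 * i - 1)) * x + a\<^sup>2) =
    x ^ 2 ^ Suc k + a ^ 2 ^ Suc k"
proof -
  let ?f = "\<lambda>i. x - a * b ^ (2 * i - 1)"
  have "(\<Prod>i = 1..2 ^ k. ?f (2 ^ k + i)) = (\<Prod>i = 1..2 ^ k. x - a * c ^ (2 * i - 1))"
  proof (rule prod.reindex_bij_witness[where i = "\<lambda>i. 2 ^ k + 1 - i" and j = "\<lambda>i. 2 ^ k + 1 - i"])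
    fix i :: nat assume i: "i \<in> {1..2 ^ k}"
    define e where "e = 2 * (2 ^ k + 1 - i) - 1"
    define d where "d = 2 * (2 ^ k + i) - 1"
    (* d + e = 2 ^ (k + 2), so that b ^ d is the inverse of b ^ e *)
    have "d + e = 2 * 2 ^ Suc k" using i by (auto simp: d_def e_def)
    hence "b ^ d * b ^ e = 1"
      using assms(2) by (simp only: power_add[symmetric] mult.commute[of 2] power_mult) simp
    moreover have "b ^ e * c ^ e = 1" using assms(1) by (simp flip: power_mult_distrib)
    ultimately have "c ^ e = b ^ d" by (metis mult.assoc mult.commute mult_1_left)
    thus "x - a * c ^ (2 * (2 ^ k + 1 - i) - 1) = ?f (2 ^ k + i)" by (simp add: d_def e_def)
  qed auto
  hence "(\<Prod>i = 1..2 ^ k. ?f i) * (\<Prod>i = 1..2 ^ k. x - a * c ^ (2 * i - 1)) =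
      (\<Prod>i = 1..2 ^ Suc k. ?f i)"
    by (simp only: power_Suc prod_atLeast1_double prod.distrib)
  also have "\<dots> = x ^ 2 ^ Suc k + a ^ 2 ^ Suc k" by (rule odd_power_product) fact
  also have "(\<Prod>i = 1..2 ^ k. ?f i) * (\<Prod>i = 1..2 ^ k. x - a * c ^ (2 * i - 1)) =
      (\<Prod>i = 1..2 ^ k. x\<^sup>2 - a * (b ^ (2 * i - 1) + c ^ (2 * i - 1)) * x + a\<^sup>2)"
  proof (unfold prod.distrib[symmetric], rule prod.cong[OF refl])
    fix i :: nat
    have *: "(x - a * p) * (x - a * r) = x\<^sup>2 - a * (p + r) * x + a\<^sup>2" if "p * r = 1" for p r
    proof -
      have "(x - a * p) * (x - a * r) = x\<^sup>2 - a * (p + r) * x + a\<^sup>2 * (p * r)"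
        by (simp add: algebra_simps power2_eq_square)
      thus ?thesis using that by simp
    qed
    have "b ^ (2 * i - 1) * c ^ (2 * i - 1) = 1" using assms(1) by (simp flip: power_mult_distrib)
    thus "?f i * (x - a * c ^ (2 * i - 1)) = x\<^sup>2 - a * (b ^ (2 * i - 1) + c ^ (2 * i - 1)) * x + a\<^sup>2"
      by (rule *)
  qed
  finally show ?thesis .
qed

text \<open>
  The linear factors of the two quadratics are \<open>x + a * b ^ e\<close>, \<open>x - a * c ^ e\<close> and
  \<open>x - a * b ^ e\<close>, \<open>x + a * c ^ e\<close>. Pairing each with its opposite instead turns the product into
  a reciprocal quadratic in \<open>x\<^sup>2\<close>, with \<open>b\<^sup>2\<close> and \<open>c\<^sup>2\<close> in place of \<open>b\<close> and \<open>c\<close>.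
\<close>
lemma antireciprocal_quadratic_product:
  fixes a b c x :: "'c :: comm_ring_1"
  assumes "b * c = 1" "b ^ 2 ^ (k + 2) = -1"
  shows "(\<Prod>i = 1..2 ^ k.
      (x\<^sup>2 + a * (b ^ (2 * i - 1) - c ^ (2 * i - 1)) * x - a\<^sup>2) *
      (x\<^sup>2 - a * (b ^ (2 * i - 1) - c ^ (2 * i - 1)) * x - a\<^sup>2)) =
    x ^ 2 ^ (k + 2) + a ^ 2 ^ (k + 2)"
proof -
  have "(\<Prod>i = 1..2 ^ k.
      (x\<^sup>2 + a * (b ^ (2 * i - 1) - c ^ (2 * i - 1)) * x - a\<^sup>2) *
      (x\<^sup>2 - a * (b ^ (2 * i - 1) - c ^ (2 * i - 1)) * x - a\<^sup>2)) =
    (\<Prod>i = 1..2 ^ k. (x\<^sup>2)\<^sup>2 - a\<^sup>2 * ((b\<^sup>2) ^ (2 * i - 1) + (c\<^sup>2) ^ (2 * i - 1)) * x\<^sup>2 + (a\<^sup>2)\<^sup>2)"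
  proof (rule prod.cong[OF refl])
    fix i :: nat
    define e where "e = 2 * i - 1"
    have *: "(x\<^sup>2 + a * (p - r) * x - a\<^sup>2) * (x\<^sup>2 - a * (p - r) * x - a\<^sup>2) =
        (x\<^sup>2)\<^sup>2 - a\<^sup>2 * (p\<^sup>2 + r\<^sup>2) * x\<^sup>2 + (a\<^sup>2)\<^sup>2" if "p * r = 1" for p r
    proof -
      have "(x\<^sup>2 + a * (p - r) * x - a\<^sup>2) * (x\<^sup>2 - a * (p - r) * x - a\<^sup>2) =
          (x\<^sup>2)\<^sup>2 - a\<^sup>2 * (p\<^sup>2 + r\<^sup>2) * x\<^sup>2 + (a\<^sup>2)\<^sup>2 + 2 * a\<^sup>2 * x\<^sup>2 * (p * r - 1)"
        by (simp add: algebra_simps power2_eq_square)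
      thus ?thesis using that by simp
    qed
    have "b ^ e * c ^ e = 1" using assms(1) by (simp flip: power_mult_distrib)
    moreover have "(b\<^sup>2) ^ e = (b ^ e)\<^sup>2" "(c\<^sup>2) ^ e = (c ^ e)\<^sup>2"
      by (simp_all only: mult.commute flip: power_mult)
    ultimately show "(x\<^sup>2 + a * (b ^ (2 * i - 1) - c ^ (2 * i - 1)) * x - a\<^sup>2) *
        (x\<^sup>2 - a * (b ^ (2 * i - 1) - c ^ (2 * i - 1)) * x - a\<^sup>2) =
        (x\<^sup>2)\<^sup>2 - a\<^sup>2 * ((b\<^sup>2) ^ (2 * i - 1) + (c\<^sup>2) ^ (2 * i - 1)) * x\<^sup>2 + (a\<^sup>2)\<^sup>2"
      unfolding e_def[symmetric] by (simp only: *)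
  qed
  also have "\<dots> = (x\<^sup>2) ^ 2 ^ Suc k + (a\<^sup>2) ^ 2 ^ Suc k"
    using assms by (intro reciprocal_quadratic_product)
      (simp_all flip: power_mult power_mult_distrib)
  finally show ?thesis by (simp flip: power_mult)
qed

lemma telescoping_two_power_product:
  fixes y :: "'c :: comm_ring_1"
  assumes "m \<le> n"
  shows "(y ^ 2 ^ m - 1) * (\<Prod>k = m..<n. y ^ 2 ^ k + 1) = y ^ 2 ^ n - 1"
  using assms
proof (induction n rule: dec_induct)
  case base
  show ?case by simp
next
  case (step n)
  have "(y ^ 2 ^ m - 1) * (\<Prod>k = m..<Suc n. y ^ 2 ^ k + 1) = (y ^ 2 ^ n - 1) * (y ^ 2 ^ n + 1)"
    using step by (simp add: mult.assoc[symmetric])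
  also have "\<dots> = y ^ 2 ^ Suc n - 1"
    by (simp add: algebra_simps mult_2 flip: power_add)
  finally show ?case .
qed

section \<open>The power of two in \<open>q + 1\<close>\<close>

text \<open>
  In \<open>q\<^sup>2 - 1 = 2 * t * (q + 1)\<close> the factor \<open>t\<close> is odd, so \<open>q + 1\<close> carries all but one of the \<open>u\<close>
  factors \<open>2\<close>. The oddness of the cofactor \<open>w\<close> is what makes \<open>b ^ (q + 1)\<close> equal to \<open>-1\<close>
  for \<open>b\<close> of order \<open>2 ^ u\<close>.
\<close>
lemma two_part_of_q_plus_1:
  fixes q t u v :: nat
  assumes "q = 2 * t + 1" "odd t" "q\<^sup>2 = 2 ^ u * v + 1" "odd v"
  obtains w where "u \<ge> 3" "q + 1 = 2 ^ (u - 1) * w" "odd w"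
proof -
  have eq: "2 * (t * (q + 1)) = 2 ^ u * v"
    using assms(1,3) by (simp add: power2_eq_square algebra_simps)
  obtain s where s: "t = 2 * s + 1" using assms(2) by (elim oddE)
  have "2 * (t * (q + 1)) = 2 ^ 3 * (t * (s + 1))"
    by (simp add: assms(1) s algebra_simps)
  hence "2 ^ 3 dvd 2 ^ u * v" by (simp flip: eq)
  hence "(2::nat) ^ 3 dvd 2 ^ u"
    using assms(4) by (subst (asm) coprime_dvd_mult_left_iff) (auto simp del: power_numeral)
  hence u: "u \<ge> 3" by (simp only: power_dvd_imp_le)
  have eq': "t * (q + 1) = 2 ^ (u - 1) * v"
    using eq u by (cases u) auto
  hence "2 ^ (u - 1) dvd q + 1"
    using assms(2) by (metis coprime_dvd_mult_right_iff coprime_power_left_iff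
        coprime_left_2_iff_odd dvd_triv_left)
  then obtain w where w: "q + 1 = 2 ^ (u - 1) * w" by (elim dvdE)
  have "t * w = v" using eq' unfolding w by simp
  hence "odd w" using assms(4) by auto
  thus ?thesis using that u w by blast
qed

section \<open>The factorization over the prime field\<close>

theorem theorem4p6:
  fixes \<iota> :: "'a :: finite_field \<Rightarrow> 'b :: finite_field"
    and \<beta> :: "nat \<Rightarrow> 'b"
    and q t u v n :: nat
  assumes "prime q" and "odd q" and "prime t" and "odd t" and "q = 2 * t + 1"
    and "CARD('a) = q" and "CARD('b) = q ^ 2" and "field_hom \<iota>"
    and "q ^ 2 = 2 ^ u * v + 1" and "odd v"
    and "\<And>k. k \<le> u \<Longrightarrow> primitive_root_of_unity (2 ^ k) (\<beta> (2 ^ k))"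
    and "n \<ge> u"
  shows "(monom 1 (2 ^ n * t) - 1 :: 'a poly) =
    (\<Prod>j = 0..t - 1. (monom 1 1 + [:4 ^ j:]) * (monom 1 1 - [:4 ^ j:])) *
    (\<Prod>k = 2..u - 1. \<Prod>i = 1..2 ^ (k - 2). \<Prod>j = 0..t - 1.
       monom 1 2 - monom (4 ^ j * quadratic_trace \<iota> (\<beta> (2 ^ k) ^ (2 * i - 1))) 1 + [:4 ^ (2 * j):]) *
    (\<Prod>r = 0..n - u. \<Prod>i = 1..2 ^ (u - 3). \<Prod>j = 0..t - 1.
       (monom 1 (2 ^ (r + 1)) + monom (4 ^ j * quadratic_trace \<iota> (\<beta> (2 ^ u) ^ (2 * i - 1))) (2 ^ r) - [:4 ^ (2 * j):]) *
       (monom 1 (2 ^ (r + 1)) - monom (4 ^ j * quadratic_trace \<iota> (\<beta> (2 ^ u) ^ (2 * i - 1))) (2 ^ r) - [:4 ^ (2 * j):]))"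
proof -
  interpret \<iota>: field_hom \<iota> by fact
  interpret h: map_poly_inj_idom_hom \<iota> ..
  let ?h = "map_poly \<iota>"
  define X :: "'b poly" where "X = monom 1 1"
  obtain w where u: "u \<ge> 3" and w: "q + 1 = 2 ^ (u - 1) * w" "odd w"
    using two_part_of_q_plus_1[OF assms(5,4,9,10)] .
  have t3: "t \<ge> 3" using assms(3,4) prime_ge_2_nat[of t] by (cases "t = 2") auto
  have idx: "{0..t - 1} = {..<t}" using t3 by auto
  have monom_X: "monom c k = [:c:] * X ^ k" for c k
    by (simp add: X_def monom_power smult_monom)

  have four: "primitive_root_of_unity t (4 :: 'b)"
  proof (rule primitive_root_of_unity_prime[OF assms(3)])
    have CHAR: "CHAR('a) = q"
      using CHAR_dvd_CARD[where ?'a = 'a] assms(1,6) primes_dvd_imp_eq[OF CHAR_prime assms(1)] by simp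
    (* q > 3, so that 2 is invertible and 4 differs from 1 *)
    have nz: "(of_nat k :: 'a) \<noteq> 0" if "0 < k" "k < q" for k
      using that by (auto simp: of_nat_eq_0_iff_char_dvd CHAR dest: dvd_imp_le)
    have "(2 :: 'a) * 2 ^ (2 * t) = 2"
      using finite_field_power_card_eq_same[of "2 :: 'a"] unfolding assms(5,6) by simp
    hence "(2 :: 'a) ^ (2 * t) = 1" using nz[of 2] t3 assms(5) by simp
    hence "(4 :: 'a) ^ t = 1" by (simp add: power_mult)
    hence "\<iota> (4 ^ t) = 1" by simp
    thus "(4 :: 'b) ^ t = 1" by (simp add: \<iota>.hom_power \<iota>.hom_numeral)
    have "(4 :: 'a) \<noteq> 1"
    proof
      assume "(4 :: 'a) = 1"
      moreover have "(of_nat 3 :: 'a) = 4 - 1" by simp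
      ultimately have "(of_nat 3 :: 'a) = 0" by simp
      thus False using nz[of 3] t3 assms(5) by simp
    qed
    hence "\<iota> 4 \<noteq> \<iota> 1" by (simp only: \<iota>.eq_iff not_False_eq_True)
    thus "(4 :: 'b) \<noteq> 1" by (simp add: \<iota>.hom_power \<iota>.hom_numeral)
  qed

  have trace: "\<iota> (quadratic_trace \<iota> x) = x + x ^ q" for x
    using embed_quadratic_trace[OF assms(8)] assms(1,6,7) by simp
  have half: "\<beta> (2 ^ k) ^ 2 ^ (k - 1) = -1" if "1 \<le> k" "k \<le> u" for k
    using assms(11)[of k] that primitive_root_half_power[of "k - 1" "\<beta> (2 ^ k)"] by simp
  have nonzero: "\<beta> (2 ^ k) \<noteq> 0" if "1 \<le> k" "k \<le> u" for k
    using half[OF that] by (auto simp: power_0_left)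
  have conj_low: "\<beta> (2 ^ k) ^ q = inverse (\<beta> (2 ^ k))" if k: "2 \<le> k" "k \<le> u - 1" for k
  proof -
    have ku: "k \<le> u" using k by simp
    have "2 ^ k dvd q + 1" unfolding w(1) by (intro dvd_mult2 le_imp_power_dvd) fact
    hence "\<beta> (2 ^ k) ^ (q + 1) = 1"
      by (subst power_eq_1_iff_dvd[OF assms(11)[OF ku]]) simp_all
    thus ?thesis using nonzero[of k] k by (simp add: field_simps)
  qed
  have conj_top: "\<beta> (2 ^ u) ^ q = - inverse (\<beta> (2 ^ u))"
  proof -
    have "\<beta> (2 ^ u) ^ (q + 1) = (-1) ^ w" unfolding w(1) power_mult using half[of u] u by simp
    also have "\<dots> = -1" using w(2) by simp
    finally show ?thesis using nonzero[of u] u by (simp add: field_simps)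
  qed

  (* the three products of the theorem, over the large field; in the third, Y is a power X ^ 2 ^ r *)
  have linear: "(\<Prod>j = 0..t - 1. (X + [:4 ^ j:]) * (X - [:4 ^ j:])) = (X ^ t) ^ 2 ^ 1 - 1"
  proof -
    have "(\<Prod>j<t. X - [:4 ^ j:]) = X ^ t - 1"
      using root_of_unity_product[OF four] t3 by simp
    moreover have "(X ^ t + 1) * (X ^ t - 1) = (X ^ t) ^ 2 ^ 1 - 1"
      by (simp add: algebra_simps power2_eq_square)
    ultimately show ?thesis
      by (simp only: idx prod.distrib root_of_unity_product_plus[OF four \<open>odd t\<close>])
  qed

  have low: "(\<Prod>i = 1..2 ^ (k - 2). \<Prod>j = 0..t - 1.
       X ^ 2 - [:4 ^ j:] * [:\<iota> (quadratic_trace \<iota> (\<beta> (2 ^ k) ^ (2 * i - 1))):] * X + [:4 ^ j:] ^ 2)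
     = (X ^ t) ^ 2 ^ (k - 1) + 1" (is "?L = _") if k: "k \<in> {2..u - 1}" for k
  proof -
    let ?b = "\<beta> (2 ^ k)"
    let ?B = "[:?b:]" and ?C = "[:inverse ?b:]"
    have ku: "1 \<le> k" "k \<le> u" using k by auto
    have BC: "?B * ?C = 1" using nonzero[OF ku] by (simp add: one_pCons)
    have k1: "Suc (k - 2) = k - 1" using k by auto
    have B: "?B ^ 2 ^ Suc (k - 2) = -1" unfolding k1
      using half[OF ku] by (simp add: poly_const_pow one_pCons)
    have T: "[:\<iota> (quadratic_trace \<iota> (?b ^ e)):] = ?B ^ e + ?C ^ e" for e
    proof -
      have "(?b ^ e) ^ q = (?b ^ q) ^ e" by (simp only: mult.commute flip: power_mult)
      thus ?thesis using conj_low[of k] k by (simp add: trace poly_const_pow)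
    qed
    have "?L = (\<Prod>j<t. \<Prod>i = 1..2 ^ (k - 2).
        X ^ 2 - [:4 ^ j:] * (?B ^ (2 * i - 1) + ?C ^ (2 * i - 1)) * X + [:4 ^ j:] ^ 2)"
      by (subst prod.swap) (simp only: T idx)
    also have "\<dots> = (X ^ t) ^ 2 ^ Suc (k - 2) + 1"
      by (simp only: reciprocal_quadratic_product[OF BC B] scaled_two_power_product[OF four \<open>odd t\<close>])
    finally show ?thesis unfolding k1 .
  qed

  have top: "(\<Prod>i = 1..2 ^ (u - 3). \<Prod>j = 0..t - 1.
       (Y ^ 2 + [:4 ^ j:] * [:\<iota> (quadratic_trace \<iota> (\<beta> (2 ^ u) ^ (2 * i - 1))):] * Y - [:4 ^ j:] ^ 2) *
       (Y ^ 2 - [:4 ^ j:] * [:\<iota> (quadratic_trace \<iota> (\<beta> (2 ^ u) ^ (2 * i - 1))):] * Y - [:4 ^ j:] ^ 2))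
     = (Y ^ t) ^ 2 ^ (u - 1) + 1" (is "?L = _") for Y
  proof -
    let ?b = "\<beta> (2 ^ u)"
    let ?B = "[:?b:]" and ?C = "[:inverse ?b:]"
    have BC: "?B * ?C = 1" using nonzero[of u] u by (simp add: one_pCons)
    have u1: "u - 3 + 2 = u - 1" using u by auto
    have B: "?B ^ 2 ^ (u - 3 + 2) = -1" unfolding u1
      using half[of u] u by (simp add: poly_const_pow one_pCons)
    have T: "[:\<iota> (quadratic_trace \<iota> (?b ^ e)):] = ?B ^ e - ?C ^ e" if "odd e" for e
    proof -
      have "(?b ^ e) ^ q = (?b ^ q) ^ e" by (simp only: mult.commute flip: power_mult)
      thus ?thesis using conj_top that by (simp add: trace poly_const_pow)
    qed
    have "?L = (\<Prod>i = 1..2 ^ (u - 3). \<Prod>j<t.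
        (Y ^ 2 + [:4 ^ j:] * (?B ^ (2 * i - 1) - ?C ^ (2 * i - 1)) * Y - [:4 ^ j:] ^ 2) *
        (Y ^ 2 - [:4 ^ j:] * (?B ^ (2 * i - 1) - ?C ^ (2 * i - 1)) * Y - [:4 ^ j:] ^ 2))"
      unfolding idx by (intro prod.cong refl, subst (1 2) T) auto
    also have "\<dots> = (\<Prod>j<t. \<Prod>i = 1..2 ^ (u - 3).
        (Y ^ 2 + [:4 ^ j:] * (?B ^ (2 * i - 1) - ?C ^ (2 * i - 1)) * Y - [:4 ^ j:] ^ 2) *
        (Y ^ 2 - [:4 ^ j:] * (?B ^ (2 * i - 1) - ?C ^ (2 * i - 1)) * Y - [:4 ^ j:] ^ 2))"
      by (rule prod.swap)
    also have "\<dots> = (Y ^ t) ^ 2 ^ (u - 3 + 2) + 1"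
      by (simp only: antireciprocal_quadratic_product[OF BC B] scaled_two_power_product[OF four \<open>odd t\<close>])
    finally show ?thesis unfolding u1 .
  qed

  have split: "(X ^ t) ^ 2 ^ n - 1 = ((X ^ t) ^ 2 ^ 1 - 1) *
      (\<Prod>k = 2..u - 1. (X ^ t) ^ 2 ^ (k - 1) + 1) *
      (\<Prod>r = 0..n - u. ((X ^ 2 ^ r) ^ t) ^ 2 ^ (u - 1) + 1)"
  proof -
    have "(\<Prod>k = 2..u - 1. (X ^ t) ^ 2 ^ (k - 1) + 1) = (\<Prod>k = 1..<u - 1. (X ^ t) ^ 2 ^ k + 1)"
      by (rule prod.reindex_bij_witness[where i = Suc and j = "\<lambda>k. k - 1"]) auto
    moreover have "(\<Prod>r = 0..n - u. ((X ^ 2 ^ r) ^ t) ^ 2 ^ (u - 1) + 1) =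
        (\<Prod>k = u - 1..<n. (X ^ t) ^ 2 ^ k + 1)"
      by (rule prod.reindex_bij_witness[where i = "\<lambda>k. k - (u - 1)" and j = "\<lambda>r. r + (u - 1)"])
        (use u \<open>n \<ge> u\<close> in \<open>auto simp: ac_simps simp flip: power_mult power_add\<close>)
    ultimately show ?thesis
      using u \<open>n \<ge> u\<close> by (simp only: telescoping_two_power_product)
  qed

  (* rewrite rules that bring the image of the right-hand side into the form of these products *)
  have const_sq: "[:4 ^ (2 * j):] = [:4 ^ j :: 'b:] ^ 2" for j
    by (simp add: poly_const_pow mult.commute power_mult)
  have const_4: "[:\<iota> (4 ^ j):] = [:4 ^ j:]" for j
    by (simp add: \<iota>.hom_mult \<iota>.hom_power \<iota>.hom_numeral)
  have const_mult: "[:\<iota> (4 ^ j * c):] = [:4 ^ j:] * [:\<iota> c:]" for j c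
    by (simp add: \<iota>.hom_mult \<iota>.hom_power \<iota>.hom_numeral)
  have monom_1: "[:1 :: 'b:] = 1" by (simp add: one_pCons)
  have pow_Suc: "X ^ 2 ^ (r + 1) = (X ^ 2 ^ r)\<^sup>2" for r
    by (simp flip: power_mult) (simp add: mult.commute)
  have h_const: "?h [:c:] = [:\<iota> c:]" for c by (simp add: \<iota>.map_poly_pCons_hom)
  note push_hom = h.hom_mult h.hom_prod h.hom_add h.hom_minus h.hom_one
    \<iota>.map_poly_hom_monom h_const \<iota>.hom_one
  note to_X = monom_X const_4 const_mult monom_1 mult_1_left power_one_right pow_Suc const_sq
  have lhs: "?h (monom 1 (2 ^ n * t) - 1) = (X ^ t) ^ 2 ^ n - 1"
    by (simp only: push_hom to_X mult.commute[of "2 ^ n"] power_mult)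
  show ?thesis
    by (rule h.injectivity)
       (simp only: lhs split, simp only: push_hom to_X linear low top cong: prod.cong)
qed

end
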